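(* Let $\mathcal C$ be the category of all sets, or the category of all finite sets, with morphisms being either all functions, all surjections, all injections, all inclusions, all bijections, or all identities (twelve categories in total). Then $\mathcal C$ admits simultaneous modality and quantifier elimination down to the class of finite Boolean combinations of atomic formulas and sentences asserting that there are precisely $n$ elements. In other words, every formula in the first-order modal language of equality $\mathcal L_{=}^{\Diamond}$ is equivalent in $\mathcal C$ to a finite Boolean combination of atomic formulas $x=y$ and sentences $\sigma_n$ ($n\in\mathbb N$), where $\sigma_n$ asserts that there are precisely $n$ elements.
   Context: Sets (including the empty set) are viewed as structures in the first-order language $\mathcal L_=$ with equality and no non-logical symbols. $\mathcal L_{=}^{\Diamond}$ is its first-order modal expansion: formulas are built from atomic formulas $x=y$ by Boolean connectives, quantifiers, and the operators $\Diamond,\Box$. For an object $W$ of $\mathcal C$ and an assignment $\nu$ of elements of $W$ to variables, $W\models_{\mathcal C}\varphi[\nu]$ is defined by the usual Tarskian clauses together with: $W\models_{\mathcal C}\Diamond\varphi[\nu]$ iff there is a morphism $f\colon W\to U$ in $\mathcal C$ with $U\models_{\mathcal C}\varphi[f\circ\nu]$; and $W\models_{\mathcal C}\Box\varphi[\nu]$ iff $U\models_{\mathcal C}\varphi[f\circ\nu]$ for every morphism $f\colon W\to U$ in $\mathcal C$. Two formulas are equivalent in $\mathcal C$ if they are satisfied by the same assignments at every object of $\mathcal C$. *)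

theory Defs
  imports Complex_Main "HOL-Library.FuncSet"
begin

section \<open>The modal language of equality\<close>

text \<open>Individual variables are natural numbers.\<close>

datatype fm =
    Eq nat nat
  | Bot
  | Neg fm
  | Conj fm fm
  | Disj fm fm
  | Imp fm fm
  | Exists nat fm
  | Forall nat fm
  | Dia fm
  | Box fm

primrec fv :: "fm \<Rightarrow> nat set" where
  "fv (Eq x y) = {x, y}"
| "fv Bot = {}"
| "fv (Neg \<phi>) = fv \<phi>"
| "fv (Conj \<phi> \<psi>) = fv \<phi> \<union> fv \<psi>"
| "fv (Disj \<phi> \<psi>) = fv \<phi> \<union> fv \<psi>"
| "fv (Imp \<phi> \<psi>) = fv \<phi> \<union> fv \<psi>"
| "fv (Exists x \<phi>) = fv \<phi> - {x}"
| "fv (Forall x \<phi>) = fv \<phi> - {x}"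
| "fv (Dia \<phi>) = fv \<phi>"
| "fv (Box \<phi>) = fv \<phi>"


section \<open>Categories of sets and modal satisfaction\<close>

record 'a set_cat =
  Obj :: "'a set set"
  Hom :: "'a set \<Rightarrow> 'a set \<Rightarrow> ('a \<Rightarrow> 'a) set"

text \<open>
  Assignments are total functions on the variables, but only the values at the free
  variables of a formula are required to lie in the object (see \<open>equivalent\<close>). In this
  way sentences can be evaluated at the empty set; the remaining values have no influence.
\<close>

primrec sat :: "'a set_cat \<Rightarrow> 'a set \<Rightarrow> (nat \<Rightarrow> 'a) \<Rightarrow> fm \<Rightarrow> bool" where
  "sat C W \<nu> (Eq x y) \<longleftrightarrow> \<nu> x = \<nu> y"
| "sat C W \<nu> Bot \<longleftrightarrow> False"
| "sat C W \<nu> (Neg \<phi>) \<longleftrightarrow> \<not> sat C W \<nu> \<phi>"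
| "sat C W \<nu> (Conj \<phi> \<psi>) \<longleftrightarrow> sat C W \<nu> \<phi> \<and> sat C W \<nu> \<psi>"
| "sat C W \<nu> (Disj \<phi> \<psi>) \<longleftrightarrow> sat C W \<nu> \<phi> \<or> sat C W \<nu> \<psi>"
| "sat C W \<nu> (Imp \<phi> \<psi>) \<longleftrightarrow> (sat C W \<nu> \<phi> \<longrightarrow> sat C W \<nu> \<psi>)"
| "sat C W \<nu> (Exists x \<phi>) \<longleftrightarrow> (\<exists>a\<in>W. sat C W (\<nu>(x := a)) \<phi>)"
| "sat C W \<nu> (Forall x \<phi>) \<longleftrightarrow> (\<forall>a\<in>W. sat C W (\<nu>(x := a)) \<phi>)"
| "sat C W \<nu> (Dia \<phi>) \<longleftrightarrow> (\<exists>U\<in>Obj C. \<exists>f\<in>Hom C W U. sat C U (f \<circ> \<nu>) \<phi>)"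
| "sat C W \<nu> (Box \<phi>) \<longleftrightarrow> (\<forall>U\<in>Obj C. \<forall>f\<in>Hom C W U. sat C U (f \<circ> \<nu>) \<phi>)"

definition equivalent :: "'a set_cat \<Rightarrow> fm \<Rightarrow> fm \<Rightarrow> bool" where
  "equivalent C \<phi> \<psi> \<longleftrightarrow>
     (\<forall>W\<in>Obj C. \<forall>\<nu>. \<nu> ` (fv \<phi> \<union> fv \<psi>) \<subseteq> W \<longrightarrow> (sat C W \<nu> \<phi> \<longleftrightarrow> sat C W \<nu> \<psi>))"

text \<open>
  The condition on free variables matters at the empty set: no assignment of a nonempty set
  of variables into it exists, so a sentence would otherwise be compared with a formula
  having free variables at nonempty objects only.
\<close>

definition admits_elimination_to :: "'a set_cat \<Rightarrow> fm set \<Rightarrow> bool" where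
  "admits_elimination_to C \<Delta> \<longleftrightarrow>
     (\<forall>\<phi>. \<exists>\<psi>\<in>\<Delta>. fv \<psi> \<subseteq> fv \<phi> \<and> equivalent C \<phi> \<psi>)"


section \<open>The six kinds of morphisms\<close>

definition all_functions :: "'a set \<Rightarrow> 'a set \<Rightarrow> ('a \<Rightarrow> 'a) set" where
  "all_functions W U = W \<rightarrow>\<^sub>E U"

definition surjections :: "'a set \<Rightarrow> 'a set \<Rightarrow> ('a \<Rightarrow> 'a) set" where
  "surjections W U = {f \<in> W \<rightarrow>\<^sub>E U. f ` W = U}"

definition injections :: "'a set \<Rightarrow> 'a set \<Rightarrow> ('a \<Rightarrow> 'a) set" where
  "injections W U = {f \<in> W \<rightarrow>\<^sub>E U. inj_on f W}"

definition inclusions :: "'a set \<Rightarrow> 'a set \<Rightarrow> ('a \<Rightarrow> 'a) set" where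
  "inclusions W U = {f \<in> W \<rightarrow>\<^sub>E U. W \<subseteq> U \<and> (\<forall>x\<in>W. f x = x)}"

definition bijections :: "'a set \<Rightarrow> 'a set \<Rightarrow> ('a \<Rightarrow> 'a) set" where
  "bijections W U = {f \<in> W \<rightarrow>\<^sub>E U. bij_betw f W U}"

definition identities :: "'a set \<Rightarrow> 'a set \<Rightarrow> ('a \<Rightarrow> 'a) set" where
  "identities W U = {f \<in> W \<rightarrow>\<^sub>E U. W = U \<and> (\<forall>x\<in>W. f x = x)}"


section \<open>The class of all sets\<close>

text \<open>
  There is no type of all sets, so the class of all sets is a parameter \<open>\<S>\<close>: a family of
  subsets of a type that contains the empty set and some infinite set and is closed under
  subsets and under adding an element. The family \<open>UNIV\<close> of all subsets of an infinite type
  is an instance. So are the subsets of a model of set theory that are extensions of its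
  elements (the sets of a Grothendieck universe, say), in which case, as for the class of
  all sets, no object is maximal with respect to inclusion.
\<close>

definition set_universe :: "'a set set \<Rightarrow> bool" where
  "set_universe \<S> \<longleftrightarrow>
     {} \<in> \<S> \<and>
     (\<exists>W\<in>\<S>. infinite W) \<and>
     (\<forall>W\<in>\<S>. \<forall>V. V \<subseteq> W \<longrightarrow> V \<in> \<S>) \<and>
     (\<forall>W\<in>\<S>. \<forall>a. insert a W \<in> \<S>)"

lemma set_universe_UNIV:
  assumes "infinite (UNIV :: 'a set)"
  shows "set_universe (UNIV :: 'a set set)"
  using assms by (auto simp: set_universe_def)


section \<open>Boolean combinations of atomic formulas and cardinality sentences\<close>

definition Conjs :: "fm list \<Rightarrow> fm" where
  "Conjs \<phi>s = foldr Conj \<phi>s (Neg Bot)"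

definition Disjs :: "fm list \<Rightarrow> fm" where
  "Disjs \<phi>s = foldr Disj \<phi>s Bot"

text \<open>\<open>\<exists>x\<^sub>0 \<dots> x\<^sub>n\<^sub>-\<^sub>1. (\<And>i<j<n. x\<^sub>i \<noteq> x\<^sub>j) \<and> (\<forall>x\<^sub>n. \<Or>i<n. x\<^sub>n = x\<^sub>i)\<close>\<close>

definition sigma :: "nat \<Rightarrow> fm" where
  "sigma n = foldr Exists [0..<n]
     (Conj (Conjs [Neg (Eq i j). j \<leftarrow> [0..<n], i \<leftarrow> [0..<j]])
           (Forall n (Disjs [Eq n i. i \<leftarrow> [0..<n]])))"

inductive_set boolean_combinations :: "fm set" where
  "Eq x y \<in> boolean_combinations"
| "sigma n \<in> boolean_combinations"
| "Bot \<in> boolean_combinations"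
| "\<phi> \<in> boolean_combinations \<Longrightarrow> Neg \<phi> \<in> boolean_combinations"
| "\<lbrakk>\<phi> \<in> boolean_combinations; \<psi> \<in> boolean_combinations\<rbrakk> \<Longrightarrow> Conj \<phi> \<psi> \<in> boolean_combinations"
| "\<lbrakk>\<phi> \<in> boolean_combinations; \<psi> \<in> boolean_combinations\<rbrakk> \<Longrightarrow> Disj \<phi> \<psi> \<in> boolean_combinations"
| "\<lbrakk>\<phi> \<in> boolean_combinations; \<psi> \<in> boolean_combinations\<rbrakk> \<Longrightarrow> Imp \<phi> \<psi> \<in> boolean_combinations"

lemma sat_Conjs: "sat C W \<nu> (Conjs \<phi>s) \<longleftrightarrow> (\<forall>\<phi>\<in>set \<phi>s. sat C W \<nu> \<phi>)"
  by (induction \<phi>s) (auto simp: Conjs_def)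

lemma sat_Disjs: "sat C W \<nu> (Disjs \<phi>s) \<longleftrightarrow> (\<exists>\<phi>\<in>set \<phi>s. sat C W \<nu> \<phi>)"
  by (induction \<phi>s) (auto simp: Disjs_def)

lemma fv_Conjs: "fv (Conjs \<phi>s) = (\<Union>\<phi>\<in>set \<phi>s. fv \<phi>)"
  by (induction \<phi>s) (auto simp: Conjs_def)

lemma fv_Disjs: "fv (Disjs \<phi>s) = (\<Union>\<phi>\<in>set \<phi>s. fv \<phi>)"
  by (induction \<phi>s) (auto simp: Disjs_def)

lemma fv_foldr_Exists: "fv (foldr Exists xs \<phi>) = fv \<phi> - set xs"
  by (induction xs) auto

lemma fv_sigma: "fv (sigma n) = {}"
  by (auto simp: sigma_def fv_foldr_Exists fv_Conjs fv_Disjs)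

lemma sat_foldr_Exists:
  "sat C W \<nu> (foldr Exists xs \<phi>) \<longleftrightarrow>
     (\<exists>\<mu>. \<mu> ` set xs \<subseteq> W \<and> (\<forall>x. x \<notin> set xs \<longrightarrow> \<mu> x = \<nu> x) \<and> sat C W \<mu> \<phi>)"
proof (induction xs arbitrary: \<nu>)
  case Nil
  have "\<mu> = \<nu>" if "\<forall>x. \<mu> x = \<nu> x" for \<mu> using that by auto
  then show ?case by auto
next
  case (Cons y xs)
  show ?case (is "_ \<longleftrightarrow> ?R")
  proof
    assume "sat C W \<nu> (foldr Exists (y # xs) \<phi>)"
    then obtain a \<mu> where "a \<in> W" "\<mu> ` set xs \<subseteq> W"
      "\<forall>x. x \<notin> set xs \<longrightarrow> \<mu> x = (\<nu>(y := a)) x" "sat C W \<mu> \<phi>"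
      by (auto simp: Cons.IH)
    then show ?R by (intro exI[of _ \<mu>]) (cases "y \<in> set xs"; auto)
  next
    assume ?R
    then obtain \<mu> where "\<mu> ` set (y # xs) \<subseteq> W"
      "\<forall>x. x \<notin> set (y # xs) \<longrightarrow> \<mu> x = \<nu> x" "sat C W \<mu> \<phi>" by blast
    then show "sat C W \<nu> (foldr Exists (y # xs) \<phi>)"
      by (auto simp: Cons.IH intro!: bexI[of _ "\<mu> y"] exI[of _ \<mu>])
  qed
qed

lemma sat_sigma: "sat C W \<nu> (sigma n) \<longleftrightarrow> finite W \<and> card W = n"
proof -
  have body: "sat C W \<mu> (Conj (Conjs [Neg (Eq i j). j \<leftarrow> [0..<n], i \<leftarrow> [0..<j]])
           (Forall n (Disjs [Eq n i. i \<leftarrow> [0..<n]]))) \<longleftrightarrow>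
       inj_on \<mu> {..<n} \<and> W \<subseteq> \<mu> ` {..<n}" for \<mu>
  proof -
    have "(\<forall>j<n. \<forall>i<j. \<mu> i \<noteq> \<mu> j) \<longleftrightarrow> inj_on \<mu> {..<n}"
      by (auto simp: inj_on_def) (metis linorder_neqE_nat order.strict_trans)+
    moreover have "sat C W \<mu> (Conjs [Neg (Eq i j). j \<leftarrow> [0..<n], i \<leftarrow> [0..<j]]) \<longleftrightarrow>
        (\<forall>j<n. \<forall>i<j. \<mu> i \<noteq> \<mu> j)"
      by (fastforce simp: sat_Conjs)
    moreover have "sat C W \<mu> (Forall n (Disjs [Eq n i. i \<leftarrow> [0..<n]])) \<longleftrightarrow> W \<subseteq> \<mu> ` {..<n}"
      by (fastforce simp: sat_Disjs)
    ultimately show ?thesis by simp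
  qed
  show ?thesis
  proof
    assume "sat C W \<nu> (sigma n)"
    then obtain \<mu> where "\<mu> ` {..<n} \<subseteq> W" "inj_on \<mu> {..<n}" "W \<subseteq> \<mu> ` {..<n}"
      unfolding sigma_def sat_foldr_Exists body by (auto simp: atLeast0LessThan)
    then have "bij_betw \<mu> {..<n} W" by (auto simp: bij_betw_def)
    then show "finite W \<and> card W = n"
      using bij_betw_finite bij_betw_same_card by fastforce
  next
    assume "finite W \<and> card W = n"
    then obtain h where h: "bij_betw h {..<n} W"
      using ex_bij_betw_nat_finite[of W] by (auto simp: atLeast0LessThan)
    let ?\<mu> = "\<lambda>x. if x < n then h x else \<nu> x"
    have "bij_betw ?\<mu> {..<n} W \<longleftrightarrow> bij_betw h {..<n} W" by (rule bij_betw_cong) simp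
    with h have "bij_betw ?\<mu> {..<n} W" by simp
    then show "sat C W \<nu> (sigma n)"
      unfolding sigma_def sat_foldr_Exists body
      by (intro exI[of _ ?\<mu>]) (auto simp: bij_betw_def atLeast0LessThan)
  qed
qed

end

theory Submission
  imports Defs
begin

text \<open>
  Whether a formula \<open>\<phi>\<close> holds at an object \<open>W\<close> under an assignment \<open>\<nu>\<close> depends only on two
  pieces of data: which free variables of \<open>\<phi>\<close> are identified by \<open>\<nu>\<close>, and the size of \<open>W\<close>,
  where all sizes from some threshold on, including the infinite ones, count as the same.
  Both are recorded by the truth values of finitely many formulas \<open>x = y\<close> and \<open>\<sigma>\<^sub>n\<close>, and a
  property determined by the truth values of finitely many formulas is a Boolean combination
  of them (\<open>boolean_combination_if_determined\<close>).

  The dependence claim is proved by a back-and-forth argument on the relation \<open>similar\<close>, as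
  in an Ehrenfeucht--Fraisse game. For a quantifier, a new element on one side has a
  counterpart on the other as long as the threshold exceeds the number of elements already
  named (\<open>similar_extend\<close>). For a modality, a morphism on one side needs a counterpart on the
  other. Bijections and identities are answered by the identity. Injections and inclusions
  are answered by the inclusion into a superset of suitable size. Arbitrary functions
  \<open>W \<rightarrow> U\<close> are answered by a function into the same \<open>U\<close>. Surjections
  need more room: they may identify named elements, which uses up elements of the domain
  without covering more of the codomain. The domains must therefore agree up to a threshold
  that exceeds the one for the codomains by the number of named elements
  (\<open>surjections_forth\<close>), and \<open>threshold\<close> grows with the nesting of modalities.
\<close>

section \<open>Similarity of pointed sets\<close>

definition same_card_below :: "nat \<Rightarrow> 'a set \<Rightarrow> 'b set \<Rightarrow> bool" where
  "same_card_below N W W' \<longleftrightarrow> (\<forall>n<N. finite W \<and> card W = n \<longleftrightarrow> finite W' \<and> card W' = n)"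

definition same_type :: "'v set \<Rightarrow> ('v \<Rightarrow> 'a) \<Rightarrow> ('v \<Rightarrow> 'b) \<Rightarrow> bool" where
  "same_type V \<nu> \<nu>' \<longleftrightarrow> (\<forall>x\<in>V. \<forall>y\<in>V. \<nu> x = \<nu> y \<longleftrightarrow> \<nu>' x = \<nu>' y)"

definition similar ::
    "nat \<Rightarrow> 'v set \<Rightarrow> 'a set \<Rightarrow> ('v \<Rightarrow> 'a) \<Rightarrow> 'b set \<Rightarrow> ('v \<Rightarrow> 'b) \<Rightarrow> bool" where
  "similar N V W \<nu> W' \<nu>' \<longleftrightarrow>
     \<nu> ` V \<subseteq> W \<and> \<nu>' ` V \<subseteq> W' \<and> same_card_below N W W' \<and> same_type V \<nu> \<nu>'"

lemma same_card_below_refl: "same_card_below N W W"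
  by (simp add: same_card_below_def)

lemma same_card_below_mono: "same_card_below N W W' \<Longrightarrow> M \<le> N \<Longrightarrow> same_card_below M W W'"
  by (auto simp: same_card_below_def)

lemma same_card_below_small:
  "same_card_below N W W' \<Longrightarrow> finite W \<Longrightarrow> card W < N \<Longrightarrow> finite W' \<and> card W' = card W"
  by (auto simp: same_card_below_def)

lemma same_card_below_large:
  "\<not> (finite W \<and> card W < N) \<Longrightarrow> \<not> (finite W' \<and> card W' < N) \<Longrightarrow> same_card_below N W W'"
  by (auto simp: same_card_below_def)

lemma same_card_below_sym: "same_card_below N W W' \<Longrightarrow> same_card_below N W' W"
  by (auto simp: same_card_below_def)

lemma similar_sym: "similar N V W \<nu> W' \<nu>' \<Longrightarrow> similar N V W' \<nu>' W \<nu>"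
  by (auto simp: similar_def same_card_below_def same_type_def)

lemma similar_mono:
  "similar N V W \<nu> W' \<nu>' \<Longrightarrow> M \<le> N \<Longrightarrow> T \<subseteq> V \<Longrightarrow> similar M T W \<nu> W' \<nu>'"
  unfolding similar_def same_type_def by (blast intro: same_card_below_mono)

lemma same_type_bij:
  assumes "same_type V \<nu> \<nu>'"
  obtains h where "bij_betw h (\<nu> ` V) (\<nu>' ` V)" "\<And>x. x \<in> V \<Longrightarrow> h (\<nu> x) = \<nu>' x"
proof -
  define h where "h a = \<nu>' (SOME x. x \<in> V \<and> \<nu> x = a)" for a
  have h: "h (\<nu> x) = \<nu>' x" if "x \<in> V" for x
  proof -
    have "(SOME y. y \<in> V \<and> \<nu> y = \<nu> x) \<in> V \<and> \<nu> (SOME y. y \<in> V \<and> \<nu> y = \<nu> x) = \<nu> x"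
      by (rule someI[of _ x]) (simp add: that)
    with that assms show ?thesis unfolding h_def same_type_def by metis
  qed
  have "bij_betw h (\<nu> ` V) (\<nu>' ` V)"
    unfolding bij_betw_def
    using h assms by (auto simp: inj_on_def same_type_def image_image)
  with h that show thesis by blast
qed

text \<open>
  Both assignments name equally many elements, fewer than \<open>N\<close>. If they exhausted \<open>W'\<close>, then
  \<open>W\<close> would have the same size as \<open>W'\<close> and be exhausted too. So a fresh element exists on
  the one side if it exists on the other.
\<close>

lemma similar_extend:
  assumes sim: "similar N (V - {x}) W \<nu> W' \<nu>'"
    and V: "finite V" "card V < N" and a: "a \<in> W"
  shows "\<exists>a'\<in>W'. similar N V W (\<nu>(x := a)) W' (\<nu>'(x := a'))"
proof (cases "a \<in> \<nu> ` (V - {x})")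
  case True
  then obtain y where y: "y \<in> V - {x}" "a = \<nu> y" by blast
  have "\<nu>' y \<in> W'" using sim y by (auto simp: similar_def)
  moreover have "similar N V W (\<nu>(x := a)) W' (\<nu>'(x := \<nu>' y))"
    using sim y a by (auto simp: similar_def same_type_def)
  ultimately show ?thesis by blast
next
  case False
  obtain h where "bij_betw h (\<nu> ` (V - {x})) (\<nu>' ` (V - {x}))"
    using sim same_type_bij unfolding similar_def by metis
  then have same: "card (\<nu> ` (V - {x})) = card (\<nu>' ` (V - {x}))"
    by (rule bij_betw_same_card)
  have "\<not> W' \<subseteq> \<nu>' ` (V - {x})"
  proof
    assume "W' \<subseteq> \<nu>' ` (V - {x})"
    then have W': "W' = \<nu>' ` (V - {x})" using sim by (auto simp: similar_def)
    have "card W' \<le> card (V - {x})" unfolding W' using V by (intro card_image_le) simp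
    also have "\<dots> \<le> card V" using V(1) by (simp add: card_mono)
    finally have "finite W" "card W = card W'"
      using same_card_below_small[of N W' W] sim V W'
      by (auto simp: similar_def same_card_below_sym)
    moreover have "\<nu> ` (V - {x}) \<subset> W" using sim False a by (auto simp: similar_def)
    ultimately have "card (\<nu> ` (V - {x})) < card W'" using psubset_card_mono by metis
    with same W' show False by simp
  qed
  then obtain a' where a': "a' \<in> W'" "a' \<notin> \<nu>' ` (V - {x})" by blast
  then have "similar N V W (\<nu>(x := a)) W' (\<nu>'(x := a'))"
    using sim a False unfolding similar_def same_type_def by (auto simp: image_iff)
  with a' show ?thesis by blast
qed

section \<open>Matching morphisms\<close>

text \<open>
  The clause of a bisimulation for the modalities: every morphism out of an object has a
  counterpart out of every similar object, at the cost of lowering the threshold. The summand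
  \<open>card V\<close> pays for the named elements that a surjection may identify. The summand \<open>1\<close>
  makes similar objects agree on being empty even if \<open>N\<close> and \<open>V\<close> are trivial: the empty set
  has a function into every set, a nonempty one has none into the empty set.
\<close>

definition forth :: "'a set_cat \<Rightarrow> bool" where
  "forth C \<longleftrightarrow>
     (\<forall>N V W W' U f. \<forall>\<nu> :: nat \<Rightarrow> 'a. \<forall>\<nu>'. finite V \<longrightarrow> W \<in> Obj C \<longrightarrow> W' \<in> Obj C \<longrightarrow> U \<in> Obj C \<longrightarrow>
        similar (N + card V + 1) V W \<nu> W' \<nu>' \<longrightarrow> f \<in> Hom C W U \<longrightarrow>
        (\<exists>U'\<in>Obj C. \<exists>f'\<in>Hom C W' U'. similar N V U (f \<circ> \<nu>) U' (f' \<circ> \<nu>')))"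

lemma forthD:
  fixes \<nu> \<nu>' :: "nat \<Rightarrow> 'a"
  assumes "forth C" "finite V" "W \<in> Obj C" "W' \<in> Obj C" "U \<in> Obj C"
    and "similar (N + card V + 1) V W \<nu> W' \<nu>'" "f \<in> Hom C W U"
  shows "\<exists>U'\<in>Obj C. \<exists>f'\<in>Hom C W' U'. similar N V U (f \<circ> \<nu>) U' (f' \<circ> \<nu>')"
  using assms unfolding forth_def by blast

lemma all_functions_forth:
  assumes sim: "similar M V W \<nu> W' \<nu>'" and MN: "N < M" and f: "f \<in> W \<rightarrow>\<^sub>E U"
  shows "\<exists>f'\<in>W' \<rightarrow>\<^sub>E U. similar N V U (f \<circ> \<nu>) U (f' \<circ> \<nu>')"
proof -
  have fU: "f a \<in> U" if "a \<in> W" for a using f that by auto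
  obtain h where h: "\<And>x. x \<in> V \<Longrightarrow> h (\<nu>' x) = \<nu> x"
    using sim same_type_bij similar_sym unfolding similar_def by metis
  define f' where "f' = restrict (\<lambda>b. if b \<in> \<nu>' ` V then f (h b) else SOME u. u \<in> U) W'"
  have ne: "U \<noteq> {}" if "b \<in> W'" for b
  proof -
    have "W \<noteq> {}"
      using that same_card_below_small[of M W W'] sim MN by (auto simp: similar_def)
    then show ?thesis using fU by blast
  qed
  have "f' \<in> W' \<rightarrow>\<^sub>E U"
    using ne h sim by (auto simp: f'_def similar_def some_in_eq image_subset_iff intro!: fU)
  moreover have f'\<nu>: "f' (\<nu>' x) = f (\<nu> x)" if "x \<in> V" for x
    using that h sim by (auto simp: f'_def similar_def)
  moreover have "similar N V U (f \<circ> \<nu>) U (f' \<circ> \<nu>')"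
    using f'\<nu> fU sim same_card_below_refl by (auto simp: similar_def same_type_def)
  ultimately show ?thesis by blast
qed

text \<open>
  If the domains are small they have equal size, and the partial bijection between the named
  elements extends to all of them. If they are large, the unnamed elements alone suffice to
  cover a small codomain. For a large codomain, identifying named elements with
  representatives of their classes and fixing all other elements leaves a large image.
\<close>

lemma surjections_forth:
  assumes sim: "similar (N + card V + 1) V W \<nu> W' \<nu>'" and V: "finite V"
    and f: "f ` W = U"
  obtains f' where "similar N V U (f \<circ> \<nu>) (f' ` W') (f' \<circ> \<nu>')" "f' ` W' = U \<or> f' ` W' \<subseteq> W'"
proof -
  let ?A = "\<nu> ` V" and ?A' = "\<nu>' ` V"
  have sub: "?A \<subseteq> W" "?A' \<subseteq> W'" and cardW: "same_card_below (N + card V + 1) W W'"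
    and ty: "same_type V \<nu> \<nu>'"
    using sim by (auto simp: similar_def)
  have fin: "finite ?A" "finite ?A'" using V by auto
  obtain h where hbij: "bij_betw h ?A' ?A" and h: "\<And>x. x \<in> V \<Longrightarrow> h (\<nu>' x) = \<nu> x"
    using sim same_type_bij similar_sym unfolding similar_def by metis
  \<comment> \<open>In two of the three cases the same codomain \<open>U\<close> will do.\<close>
  have onto_U: "similar N V U (f \<circ> \<nu>) (f' ` W') (f' \<circ> \<nu>')"
    if "f' ` W' = U" "\<And>x. x \<in> V \<Longrightarrow> f' (\<nu>' x) = f (\<nu> x)" for f'
  proof -
    have "same_type V (f \<circ> \<nu>) (f' \<circ> \<nu>')" using that(2) by (simp add: same_type_def)
    moreover have "(f \<circ> \<nu>) ` V \<subseteq> U" unfolding f[symmetric] using sub(1) by auto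
    moreover have "(f' \<circ> \<nu>') ` V \<subseteq> f' ` W'" using sub(2) by auto
    ultimately show ?thesis unfolding similar_def that(1) by (simp add: same_card_below_refl)
  qed
  show thesis
  proof (cases "finite W \<and> card W < N + card V + 1")
    case True
    then have eq: "finite W" "finite W'" "card W' = card W"
      using same_card_below_small[OF cardW] by auto
    have "card (W' - ?A') = card (W - ?A)"
      using eq sub bij_betw_same_card[OF hbij] by (simp add: card_Diff_subset fin)
    then obtain g where g: "bij_betw g (W' - ?A') (W - ?A)"
      using eq finite_same_card_bij[of "W' - ?A'" "W - ?A"] by auto
    define k where "k b = (if b \<in> ?A' then h b else g b)" for b
    have "bij_betw k (?A' \<union> (W' - ?A')) (?A \<union> (W - ?A))"
      unfolding k_def by (rule bij_betw_disjoint_Un) (use hbij g in auto)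
    then have "k ` W' = W" using sub by (simp add: bij_betw_def Un_absorb1)
    then have "(f \<circ> k) ` W' = U" using f by (metis image_comp)
    moreover have "(f \<circ> k) (\<nu>' x) = f (\<nu> x)" if "x \<in> V" for x
      using that h by (simp add: k_def)
    ultimately show thesis using onto_U that by blast
  next
    case False
    then have large: "\<not> (finite W' \<and> card W' < N + card V + 1)"
      using same_card_below_small[OF same_card_below_sym[OF cardW]] by auto
    have A'V: "card ?A' \<le> card V" using V by (rule card_image_le)
    have rest: "\<not> (finite (W' - ?A') \<and> card (W' - ?A') < N + 1)"
    proof
      assume *: "finite (W' - ?A') \<and> card (W' - ?A') < N + 1"
      then have "finite W'" using fin by auto
      then have "card W' \<le> card (W' - ?A') + card ?A'"
        using sub fin by (simp add: card_Diff_subset card_mono)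
      with * A'V large \<open>finite W'\<close> show False by linarith
    qed
    show thesis
    proof (cases "finite U \<and> card U < N")
      case True
      have "\<exists>T\<subseteq>W' - ?A'. finite T \<and> card T = card U"
      proof (cases "finite (W' - ?A')")
        case True
        then have "card U \<le> card (W' - ?A')" using rest \<open>finite U \<and> card U < N\<close> by linarith
        then show ?thesis using obtain_subset_with_card_n by metis
      next
        case False
        then show ?thesis using infinite_arbitrarily_large by metis
      qed
      then obtain T where T: "T \<subseteq> W' - ?A'" "finite T" "card T = card U" by blast
      then obtain g where g: "bij_betw g T U"
        using finite_same_card_bij True by blast
      have "W \<noteq> {}" using False by auto
      then obtain u where u: "u \<in> U" using f by auto
      define f' where "f' b = (if b \<in> ?A' then f (h b) else if b \<in> T then g b else u)" for b
      have "f' ` W' = U"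
      proof
        show "f' ` W' \<subseteq> U" using f h sub u g by (auto simp: f'_def bij_betw_def)
        have "U = f' ` T" using g T(1) by (auto simp: f'_def bij_betw_def)
        also have "\<dots> \<subseteq> f' ` W'" using T(1) by blast
        finally show "U \<subseteq> f' ` W'" .
      qed
      moreover have "f' (\<nu>' x) = f (\<nu> x)" if "x \<in> V" for x
        using that h by (simp add: f'_def)
      ultimately show thesis using onto_U that by blast
    next
      case bigU: False
      define r where "r a = (SOME y. y \<in> V \<and> f (\<nu> y) = a)" for a
      have r: "r (f (\<nu> x)) \<in> V \<and> f (\<nu> (r (f (\<nu> x)))) = f (\<nu> x)" if "x \<in> V" for x
        unfolding r_def by (rule someI[of _ x]) (simp add: that)
      define f' where "f' b = (if b \<in> ?A' then \<nu>' (r (f (h b))) else b)" for b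
      have f'\<nu>: "f' (\<nu>' x) = \<nu>' (r (f (\<nu> x)))" if "x \<in> V" for x
        using that h by (simp add: f'_def)
      have sub': "f' ` W' \<subseteq> W'" using r h sub by (auto simp: f'_def)
      have "W' - ?A' \<subseteq> f' ` W'" by (force simp: f'_def)
      then have "\<not> (finite (f' ` W') \<and> card (f' ` W') < N)"
        using rest by (auto dest: finite_subset card_mono[rotated])
      then have "same_card_below N U (f' ` W')" using bigU same_card_below_large by blast
      moreover have "same_type V (f \<circ> \<nu>) (f' \<circ> \<nu>')"
      proof -
        have "\<nu>' (r (f (\<nu> x))) = \<nu>' (r (f (\<nu> y))) \<longleftrightarrow> f (\<nu> x) = f (\<nu> y)"
          if "x \<in> V" "y \<in> V" for x y
          using ty r[OF that(1)] r[OF that(2)] unfolding same_type_def by metis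
        then show ?thesis using f'\<nu> by (auto simp: same_type_def)
      qed
      ultimately have "similar N V U (f \<circ> \<nu>) (f' ` W') (f' \<circ> \<nu>')"
        using f sub by (auto simp: similar_def)
      with sub' that show thesis by blast
    qed
  qed
qed

text \<open>
  Injective morphisms preserve the type of an assignment, so only sizes matter: the codomain
  must be matched by a superset of the other domain, which the identity maps into it.
\<close>

lemma injections_forth:
  fixes W' :: "'a set"
  assumes sim: "similar M V W \<nu> W' \<nu>'" and NM: "N \<le> M"
    and f: "f ` W \<subseteq> U" "inj_on f W" and inf: "infinite (UNIV :: 'a set)"
  obtains U' where "W' \<subseteq> U'" "U' = W' \<or> finite U'" "similar N V U (f \<circ> \<nu>) U' \<nu>'"
proof -
  have "\<exists>U'. W' \<subseteq> U' \<and> (U' = W' \<or> finite U') \<and> same_card_below N U U'"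
  proof -
    have ext: "\<exists>U'. W' \<subseteq> U' \<and> finite U' \<and> card U' = m" if "finite W'" "card W' \<le> m" for m
    proof -
      have "infinite (- W')" using inf that(1) by (simp add: Compl_eq_Diff_UNIV)
      then obtain T where "finite T" "card T = m - card W'" "T \<subseteq> - W'"
        using infinite_arbitrarily_large by metis
      moreover from this that(1) have "card (W' \<union> T) = card W' + card T"
        by (intro card_Un_disjoint) auto
      ultimately show ?thesis using that by (intro exI[of _ "W' \<union> T"]) auto
    qed
    show ?thesis
    proof (cases "finite U \<and> card U < N")
      case True
      then have W: "finite W" "card W \<le> card U"
        using inj_on_finite[OF f(2,1)] card_inj_on_le[OF f(2,1)] by auto
      then have "finite W' \<and> card W' = card W"
        using same_card_below_small[of M W W'] True sim NM by (auto simp: similar_def)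
      then obtain U' where "W' \<subseteq> U'" "finite U'" "card U' = card U"
        using ext[of "card U"] W by auto
      then show ?thesis using True unfolding same_card_below_def by metis
    next
      case bigU: False
      show ?thesis
      proof (cases "finite W'")
        case True
        with ext[of "max N (card W')"] obtain U' where
          "W' \<subseteq> U'" "finite U'" "card U' = max N (card W')" by force
        with bigU have "same_card_below N U U'" by (intro same_card_below_large) auto
        with \<open>W' \<subseteq> U'\<close> \<open>finite U'\<close> show ?thesis by blast
      next
        case False
        with bigU have "same_card_below N U W'" by (intro same_card_below_large) auto
        then show ?thesis by blast
      qed
    qed
  qed
  then obtain U' where U': "W' \<subseteq> U'" "U' = W' \<or> finite U'" "same_card_below N U U'" by blast
  moreover have "similar N V U (f \<circ> \<nu>) U' \<nu>'"
  proof -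
    have "f (\<nu> x) = f (\<nu> y) \<longleftrightarrow> \<nu> x = \<nu> y" if "x \<in> V" "y \<in> V" for x y
      using inj_on_eq_iff[OF f(2)] that sim by (auto simp: similar_def)
    moreover have "(f \<circ> \<nu>) ` V \<subseteq> U" using f(1) sim by (auto simp: similar_def)
    ultimately show ?thesis using U' sim by (auto simp: similar_def same_type_def)
  qed
  ultimately show thesis using that by blast
qed

lemma forth_if_standard:
  fixes \<S> :: "'a set set" and C :: "'a set_cat"
  assumes \<S>: "set_universe \<S>"
    and Obj: "Obj C \<in> {\<S>, {W \<in> \<S>. finite W}}"
    and Hom: "Hom C \<in> {all_functions, surjections, injections, inclusions, bijections, identities}"
  shows "forth C"
  unfolding forth_def
proof (intro allI impI)
  fix N V W W' U f and \<nu> \<nu>' :: "nat \<Rightarrow> 'a"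
  assume V: "finite V" and W': "W' \<in> Obj C" and U: "U \<in> Obj C"
    and sim: "similar (N + card V + 1) V W \<nu> W' \<nu>'" and f: "f \<in> Hom C W U"
  \<comment> \<open>Closure under adding an element puts all finite sets into the category, so the supersets
    that answer injections and inclusions are objects.\<close>
  have inf: "infinite (UNIV :: 'a set)"
    using \<S> finite_subset[OF subset_UNIV] unfolding set_universe_def by metis
  have fin_S: "F \<in> \<S>" if "finite F" for F
    using that by induction (use \<S> in \<open>auto simp: set_universe_def\<close>)
  have fin_Obj: "F \<in> Obj C" if "finite F" for F
    using fin_S[OF that] that Obj by auto
  have sub_Obj: "T \<in> Obj C" if "T \<subseteq> X" "X \<in> Obj C" for T X
    using that Obj \<S> finite_subset[OF that(1)] unfolding set_universe_def by blast
  let ?goal = "\<exists>U'\<in>Obj C. \<exists>f'\<in>Hom C W' U'. similar N V U (f \<circ> \<nu>) U' (f' \<circ> \<nu>')"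
  \<comment> \<open>Morphisms are undefined outside their domain, which does not affect the assignments.\<close>
  have restr: "similar N V U (f \<circ> \<nu>) U' (restrict g W' \<circ> \<nu>')"
    if "similar N V U (f \<circ> \<nu>) U' (g \<circ> \<nu>')" for g U'
  proof -
    have "restrict g W' (\<nu>' x) = g (\<nu>' x)" if "x \<in> V" for x
      using sim that by (auto simp: similar_def)
    with that show ?thesis by (auto simp: similar_def same_type_def)
  qed
  consider "Hom C = all_functions" | "Hom C = surjections"
    | "Hom C = injections \<or> Hom C = inclusions" | "Hom C = bijections \<or> Hom C = identities"
    using Hom by auto
  then show ?goal
  proof cases
    case 1
    then show ?thesis
      using all_functions_forth[OF sim, of N f U] f U by (auto simp: all_functions_def)
  next
    case 2
    then have "f ` W = U" using f by (auto simp: surjections_def)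
    then obtain g where g: "similar N V U (f \<circ> \<nu>) (g ` W') (g \<circ> \<nu>')" "g ` W' = U \<or> g ` W' \<subseteq> W'"
      by (rule surjections_forth[OF sim V])
    then have "g ` W' \<in> Obj C" using U W' sub_Obj by metis
    moreover have "restrict g W' \<in> Hom C W' (g ` W')" by (simp add: 2 surjections_def)
    ultimately show ?thesis using restr[OF g(1)] by blast
  next
    case 3
    then have "f ` W \<subseteq> U" "inj_on f W"
      using f by (auto simp: injections_def inclusions_def inj_on_def)
    then obtain U' where U': "W' \<subseteq> U'" "U' = W' \<or> finite U'" "similar N V U (f \<circ> \<nu>) U' \<nu>'"
      using injections_forth[OF sim, of N f U] inf by auto
    then have "U' \<in> Obj C" using W' fin_Obj by metis
    moreover have "restrict id W' \<in> W' \<rightarrow>\<^sub>E U'" using U'(1) by auto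
    then have "restrict id W' \<in> Hom C W' U'"
      using 3 U'(1) by (auto simp: injections_def inclusions_def inj_on_def)
    ultimately show ?thesis using restr[of U' id] U'(3) by auto
  next
    case 4
    then have f: "bij_betw f W U"
    proof
      assume "Hom C = identities"
      then have "U = W" "\<And>a. a \<in> W \<Longrightarrow> f a = a" using f by (auto simp: identities_def)
      then show ?thesis using bij_betw_cong[of W f id W] by simp
    qed (use f in \<open>simp add: bijections_def\<close>)
    have "f (\<nu> x) = f (\<nu> y) \<longleftrightarrow> \<nu> x = \<nu> y" if "x \<in> V" "y \<in> V" for x y
      using f inj_on_eq_iff[of f W] that sim by (auto simp: similar_def bij_betw_def)
    moreover have "same_card_below N U W'"
      using sim bij_betw_finite[OF f] bij_betw_same_card[OF f]
      by (simp add: similar_def same_card_below_def)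
    moreover have "(f \<circ> \<nu>) ` V \<subseteq> U" using f sim by (auto simp: similar_def bij_betw_def)
    ultimately have "similar N V U (f \<circ> \<nu>) W' (id \<circ> \<nu>')"
      using sim by (auto simp: similar_def same_type_def)
    moreover have "restrict id W' \<in> Hom C W' W'"
      using 4 by (auto simp: bijections_def identities_def bij_betw_def inj_on_def)
    ultimately show ?thesis using restr W' by blast
  qed
qed

section \<open>Invariance of satisfaction\<close>

text \<open>
  At a quantifier the increment keeps the threshold above the number of named elements, as
  \<open>similar_extend\<close> demands. At a modality it is the loss allowed by \<open>forth\<close>.
\<close>

primrec threshold :: "fm \<Rightarrow> nat" where
  "threshold (Eq x y) = 0"
| "threshold Bot = 0"
| "threshold (Neg \<phi>) = threshold \<phi>"
| "threshold (Conj \<phi> \<psi>) = max (threshold \<phi>) (threshold \<psi>)"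
| "threshold (Disj \<phi> \<psi>) = max (threshold \<phi>) (threshold \<psi>)"
| "threshold (Imp \<phi> \<psi>) = max (threshold \<phi>) (threshold \<psi>)"
| "threshold (Exists x \<phi>) = threshold \<phi> + card (fv \<phi>) + 1"
| "threshold (Forall x \<phi>) = threshold \<phi> + card (fv \<phi>) + 1"
| "threshold (Dia \<phi>) = threshold \<phi> + card (fv \<phi>) + 1"
| "threshold (Box \<phi>) = threshold \<phi> + card (fv \<phi>) + 1"

lemma finite_fv: "finite (fv \<phi>)"
  by (induction \<phi>) auto

lemma quantifier_step:
  assumes "similar (threshold \<phi> + card (fv \<phi>) + 1) (fv \<phi> - {x}) W \<nu> W' \<nu>'" and "a \<in> W"
  obtains a' where "a' \<in> W'" "similar (threshold \<phi>) (fv \<phi>) W (\<nu>(x := a)) W' (\<nu>'(x := a'))"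
proof -
  have "\<exists>a'\<in>W'. similar (threshold \<phi> + card (fv \<phi>) + 1) (fv \<phi>) W (\<nu>(x := a)) W' (\<nu>'(x := a'))"
    by (rule similar_extend) (use assms finite_fv in auto)
  then show thesis using that similar_mono[OF _ _ subset_refl] by fastforce
qed

lemma sat_similar:
  assumes C: "forth C" and "W \<in> Obj C" "W' \<in> Obj C"
    and "similar (threshold \<phi>) (fv \<phi>) W \<nu> W' \<nu>'"
  shows "sat C W \<nu> \<phi> \<longleftrightarrow> sat C W' \<nu>' \<phi>"
  using assms(2-)
proof (induction \<phi> arbitrary: W \<nu> W' \<nu>')
  case (Eq x y)
  then show ?case by (auto simp: similar_def same_type_def)
next
  case Bot
  show ?case by simp
next
  case (Neg \<phi>)
  then show ?case by simp
next
  case (Conj \<phi> \<psi>)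
  then show ?case
    using similar_mono[OF Conj.prems(3), of "threshold \<phi>" "fv \<phi>"]
      similar_mono[OF Conj.prems(3), of "threshold \<psi>" "fv \<psi>"] by simp
next
  case (Disj \<phi> \<psi>)
  then show ?case
    using similar_mono[OF Disj.prems(3), of "threshold \<phi>" "fv \<phi>"]
      similar_mono[OF Disj.prems(3), of "threshold \<psi>" "fv \<psi>"] by simp
next
  case (Imp \<phi> \<psi>)
  then show ?case
    using similar_mono[OF Imp.prems(3), of "threshold \<phi>" "fv \<phi>"]
      similar_mono[OF Imp.prems(3), of "threshold \<psi>" "fv \<psi>"] by simp
next
  case (Exists x \<phi>)
  have "sat C W' \<nu>' (Exists x \<phi>)" if *: "W \<in> Obj C" "W' \<in> Obj C"
    "similar (threshold (Exists x \<phi>)) (fv (Exists x \<phi>)) W \<nu> W' \<nu>'"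
    "sat C W \<nu> (Exists x \<phi>)" for W W' \<nu> \<nu>'
  proof -
    obtain a where a: "a \<in> W" "sat C W (\<nu>(x := a)) \<phi>" using *(4) by auto
    obtain a' where "a' \<in> W'" "similar (threshold \<phi>) (fv \<phi>) W (\<nu>(x := a)) W' (\<nu>'(x := a'))"
      using quantifier_step[OF *(3)[unfolded fv.simps threshold.simps] a(1)] .
    with a(2) Exists.IH[OF *(1,2)] show ?thesis by auto
  qed
  from this[OF Exists.prems] this[OF Exists.prems(2,1) similar_sym[OF Exists.prems(3)]]
  show ?case by blast
next
  case (Forall x \<phi>)
  have "sat C W \<nu> (Forall x \<phi>)" if *: "W \<in> Obj C" "W' \<in> Obj C"
    "similar (threshold (Forall x \<phi>)) (fv (Forall x \<phi>)) W \<nu> W' \<nu>'"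
    "sat C W' \<nu>' (Forall x \<phi>)" for W W' \<nu> \<nu>'
  proof -
    have "sat C W (\<nu>(x := a)) \<phi>" if a: "a \<in> W" for a
    proof -
      obtain a' where "a' \<in> W'" "similar (threshold \<phi>) (fv \<phi>) W (\<nu>(x := a)) W' (\<nu>'(x := a'))"
        using quantifier_step[OF *(3)[unfolded fv.simps threshold.simps] a] .
      with *(4) Forall.IH[OF *(1,2)] show ?thesis by auto
    qed
    then show ?thesis by simp
  qed
  from this[OF Forall.prems] this[OF Forall.prems(2,1) similar_sym[OF Forall.prems(3)]]
  show ?case by blast
next
  case (Dia \<phi>)
  have "sat C W' \<nu>' (Dia \<phi>)" if *: "W \<in> Obj C" "W' \<in> Obj C"
    "similar (threshold (Dia \<phi>)) (fv (Dia \<phi>)) W \<nu> W' \<nu>'"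
    "sat C W \<nu> (Dia \<phi>)" for W W' \<nu> \<nu>'
  proof -
    obtain U f where U: "U \<in> Obj C" "f \<in> Hom C W U" and s: "sat C U (f \<circ> \<nu>) \<phi>" using *(4) by auto
    obtain U' f' where U': "U' \<in> Obj C" "f' \<in> Hom C W' U'"
      "similar (threshold \<phi>) (fv \<phi>) U (f \<circ> \<nu>) U' (f' \<circ> \<nu>')"
      using forthD[OF C finite_fv *(1,2) U(1) *(3)[unfolded fv.simps threshold.simps] U(2)] by blast
    then have "sat C U' (f' \<circ> \<nu>') \<phi>" using Dia.IH[OF U(1) U'(1,3)] s by blast
    with U' show ?thesis by auto
  qed
  from this[OF Dia.prems] this[OF Dia.prems(2,1) similar_sym[OF Dia.prems(3)]]
  show ?case by blast
next
  case (Box \<phi>)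
  have "sat C W \<nu> (Box \<phi>)" if *: "W \<in> Obj C" "W' \<in> Obj C"
    "similar (threshold (Box \<phi>)) (fv (Box \<phi>)) W \<nu> W' \<nu>'"
    "sat C W' \<nu>' (Box \<phi>)" for W W' \<nu> \<nu>'
  proof -
    have "sat C U (f \<circ> \<nu>) \<phi>" if U: "U \<in> Obj C" "f \<in> Hom C W U" for U f
    proof -
      obtain U' f' where U': "U' \<in> Obj C" "f' \<in> Hom C W' U'"
        "similar (threshold \<phi>) (fv \<phi>) U (f \<circ> \<nu>) U' (f' \<circ> \<nu>')"
        using forthD[OF C finite_fv *(1,2) U(1) *(3)[unfolded fv.simps threshold.simps] U(2)] by blast
      then have "sat C U' (f' \<circ> \<nu>') \<phi>" using *(4) by auto
      then show ?thesis using Box.IH[OF U(1) U'(1,3)] by blast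
    qed
    then show ?thesis by simp
  qed
  from this[OF Box.prems] this[OF Box.prems(2,1) similar_sym[OF Box.prems(3)]]
  show ?case by blast
qed

section \<open>Elimination\<close>

text \<open>
  Shannon expansion: split on the truth value of one formula of \<open>L\<close> at a time. The domain
  \<open>Z\<close> of points shrinks with each split until \<open>P\<close> is constant on it.
\<close>

lemma boolean_combination_if_determined:
  assumes "finite L" and "L \<subseteq> boolean_combinations"
    and "\<And>W \<nu> W' \<nu>'. (W, \<nu>) \<in> Z \<Longrightarrow> (W', \<nu>') \<in> Z \<Longrightarrow>
           \<forall>\<chi>\<in>L. sat C W \<nu> \<chi> \<longleftrightarrow> sat C W' \<nu>' \<chi> \<Longrightarrow> P W \<nu> \<longleftrightarrow> P W' \<nu>'"
  shows "\<exists>\<psi>\<in>boolean_combinations. fv \<psi> \<subseteq> (\<Union>\<chi>\<in>L. fv \<chi>) \<and>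
           (\<forall>(W, \<nu>)\<in>Z. P W \<nu> \<longleftrightarrow> sat C W \<nu> \<psi>)"
  using assms
proof (induction L arbitrary: Z rule: finite_induct)
  case empty
  show ?case
  proof (cases "\<exists>(W, \<nu>)\<in>Z. P W \<nu>")
    case True
    with empty.prems(2) show ?thesis
      by (intro bexI[of _ "Neg Bot"]) (auto intro: boolean_combinations.intros)
  next
    case False
    then show ?thesis by (intro bexI[of _ Bot]) (auto intro: boolean_combinations.intros)
  qed
next
  case (insert \<chi> L)
  let ?F = "\<Union>\<chi>\<in>L. fv \<chi>"
  have L: "L \<subseteq> boolean_combinations" and \<chi>: "\<chi> \<in> boolean_combinations"
    using insert.prems(1) by auto
  have "\<exists>\<psi>\<in>boolean_combinations. fv \<psi> \<subseteq> ?F \<and>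
      (\<forall>(W, \<nu>)\<in>{(W, \<nu>) \<in> Z. sat C W \<nu> \<chi> = b}. P W \<nu> \<longleftrightarrow> sat C W \<nu> \<psi>)" for b
    by (rule insert.IH[OF L], rule insert.prems(2)) auto
  from this[of True] this[of False] obtain \<psi>1 \<psi>2 where
    "\<psi>1 \<in> boolean_combinations" "fv \<psi>1 \<subseteq> ?F"
    "\<And>W \<nu>. (W, \<nu>) \<in> Z \<Longrightarrow> sat C W \<nu> \<chi> \<Longrightarrow> (P W \<nu> \<longleftrightarrow> sat C W \<nu> \<psi>1)"
    "\<psi>2 \<in> boolean_combinations" "fv \<psi>2 \<subseteq> ?F"
    "\<And>W \<nu>. (W, \<nu>) \<in> Z \<Longrightarrow> \<not> sat C W \<nu> \<chi> \<Longrightarrow> (P W \<nu> \<longleftrightarrow> sat C W \<nu> \<psi>2)"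
    by auto
  note \<psi> = this
  have "P W \<nu> \<longleftrightarrow> sat C W \<nu> (Disj (Conj \<chi> \<psi>1) (Conj (Neg \<chi>) \<psi>2))" if "(W, \<nu>) \<in> Z" for W \<nu>
    using \<psi>(3,6)[OF that] by (cases "sat C W \<nu> \<chi>") simp_all
  with \<psi>(1,2,4,5) \<chi> show ?case
    by (intro bexI[of _ "Disj (Conj \<chi> \<psi>1) (Conj (Neg \<chi>) \<psi>2)"])
      (auto intro!: boolean_combinations.intros)
qed

theorem mainTheorem2:
  fixes \<S> :: "'a set set" and C :: "'a set_cat"
  assumes "set_universe \<S>"
    and "Obj C \<in> {\<S>, {W \<in> \<S>. finite W}}"
    and "Hom C \<in> {all_functions, surjections, injections, inclusions, bijections, identities}"
  shows "admits_elimination_to C boolean_combinations"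
  unfolding admits_elimination_to_def
proof
  fix \<phi>
  let ?E = "(\<lambda>(x, y). Eq x y) ` (fv \<phi> \<times> fv \<phi>)" and ?S = "sigma ` {..<threshold \<phi>}"
  let ?Z = "{(W, \<nu>). W \<in> Obj C \<and> \<nu> ` fv \<phi> \<subseteq> W}"
  have "\<exists>\<psi>\<in>boolean_combinations. fv \<psi> \<subseteq> (\<Union>\<chi>\<in>?E \<union> ?S. fv \<chi>) \<and>
      (\<forall>(W, \<nu>)\<in>?Z. sat C W \<nu> \<phi> \<longleftrightarrow> sat C W \<nu> \<psi>)"
  proof (rule boolean_combination_if_determined)
    show "finite (?E \<union> ?S)" by (simp add: finite_fv)
    show "?E \<union> ?S \<subseteq> boolean_combinations" by (auto intro: boolean_combinations.intros)
  next
    fix W \<nu> W' \<nu>'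
    assume Z: "(W, \<nu>) \<in> ?Z" "(W', \<nu>') \<in> ?Z"
      and agree: "\<forall>\<chi>\<in>?E \<union> ?S. sat C W \<nu> \<chi> \<longleftrightarrow> sat C W' \<nu>' \<chi>"
    have "sat C W \<nu> (Eq x y) \<longleftrightarrow> sat C W' \<nu>' (Eq x y)" if "x \<in> fv \<phi>" "y \<in> fv \<phi>" for x y
      using agree that by blast
    then have "same_type (fv \<phi>) \<nu> \<nu>'" by (simp add: same_type_def)
    moreover have "sat C W \<nu> (sigma n) \<longleftrightarrow> sat C W' \<nu>' (sigma n)" if "n < threshold \<phi>" for n
      using agree that by blast
    then have "same_card_below (threshold \<phi>) W W'"
      unfolding same_card_below_def sat_sigma by blast
    ultimately have "similar (threshold \<phi>) (fv \<phi>) W \<nu> W' \<nu>'" using Z by (simp add: similar_def)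
    then show "sat C W \<nu> \<phi> \<longleftrightarrow> sat C W' \<nu>' \<phi>"
      using sat_similar[OF forth_if_standard[OF assms]] Z by simp
  qed
  then obtain \<psi> where "\<psi> \<in> boolean_combinations" "fv \<psi> \<subseteq> (\<Union>\<chi>\<in>?E \<union> ?S. fv \<chi>)"
    "\<forall>(W, \<nu>)\<in>?Z. sat C W \<nu> \<phi> \<longleftrightarrow> sat C W \<nu> \<psi>" by blast
  moreover from this(2) have "fv \<psi> \<subseteq> fv \<phi>" by (auto simp: fv_sigma)
  ultimately show "\<exists>\<psi>\<in>boolean_combinations. fv \<psi> \<subseteq> fv \<phi> \<and> equivalent C \<phi> \<psi>"
    by (intro bexI[of _ \<psi>]) (auto simp: equivalent_def image_Un)
qed

end
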